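(* Let $\mathcal D$ be a family of nonnegative random variables with finite positive expectation that is stochastically dominated at the second order, with dominated element $Z^{\mathcal D}$, and let $g^{\mathcal D}(x)=\mathbb E[\max(xZ^{\mathcal D},1)]$. For every instance of SEBP whose processing times satisfy $P_1,\dots,P_n\in\mathcal D$, $$\frac{\mathrm{LEPT}_{\mathcal F}}{OPT_{\mathcal P}}\le\sup_{t\in(0,1]}\Big[\Big(2-\frac1t\Big)g^{\mathcal D}(t)+\Big(\frac1t-1\Big)g^{\mathcal D}(2t)\Big].$$
   Context: $Y\succeq_{(2)}Z$ means $\mathbb E[u(Y)]\ge\mathbb E[u(Z)]$ for every nondecreasing concave $u$. A family $\mathcal D$ of nonnegative random variables with finite positive expectation is stochastically dominated at the second order if there is a nonnegative random variable $Z^{\mathcal D}$ with $\mathbb E[Z^{\mathcal D}]=1$ and $X/\mathbb E[X]\succeq_{(2)}Z^{\mathcal D}$ for all $X\in\mathcal D$. SEBP: an instance consists of $m$ identical machines with unit regular capacity and $n>m$ jobs with mutually independent nonnegative processing times $P_1,\dots,P_n$ of finite expectation. A scheduling policy maps realizations to feasible schedules (start times and machine assignments, no machine running two jobs at once) non-anticipatively; its cost is $\Phi(\Pi)=\mathbb E[\sum_i\max(X_i^\Pi,1)]$ where $X_i^\Pi$ is the latest completion time on machine $i$; $OPT_{\mathcal P}$ is the infimum of $\Phi$ over all scheduling policies. $\mathrm{LEPT}_{\mathcal F}$ considers jobs in nonincreasing order of $\mathbb E[P_j]$ and assigns each to a machine with currently smallest total expected load; the assignment is fixed in advance, machines process their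 jobs without idle time, and $\mathrm{LEPT}_{\mathcal F}$ also denotes its cost. *)

theory Defs
  imports "HOL-Probability.Probability"
begin

text \<open>
  The integrability premises only say that the two expectations exist; for nonnegative
  integrable \<open>Y\<close> and \<open>Z\<close> they hold for every nondecreasing concave \<open>u\<close>.
\<close>

definition ssd :: "'a measure \<Rightarrow> ('a \<Rightarrow> real) \<Rightarrow> 'b measure \<Rightarrow> ('b \<Rightarrow> real) \<Rightarrow> bool" where
  "ssd M Y N Z \<longleftrightarrow>
     (\<forall>u :: real \<Rightarrow> real. mono u \<longrightarrow> concave_on UNIV u \<longrightarrow>
        integrable M (\<lambda>\<omega>. u (Y \<omega>)) \<longrightarrow> integrable N (\<lambda>\<omega>. u (Z \<omega>)) \<longrightarrow>
        (\<integral>\<omega>. u (Y \<omega>) \<partial>M) \<ge> (\<integral>\<omega>. u (Z \<omega>) \<partial>N))"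

text \<open>
  Membership of a random variable in a family depends on its distribution only, so a family
  is a set of laws on the reals; the law \<open>\<mu>\<close> stands for the identity on the
  probability space \<open>\<mu>\<close>.
\<close>

definition rv_family :: "real measure set \<Rightarrow> bool" where
  "rv_family \<D> \<longleftrightarrow>
     (\<forall>\<mu>\<in>\<D>. prob_space \<mu> \<and> sets \<mu> = sets borel \<and> (AE x in \<mu>. 0 \<le> x) \<and>
        integrable \<mu> (\<lambda>x. x) \<and> 0 < (\<integral>x. x \<partial>\<mu>))"

definition dominated_element ::
    "real measure set \<Rightarrow> 'b measure \<Rightarrow> ('b \<Rightarrow> real) \<Rightarrow> bool" where
  "dominated_element \<D> N Z \<longleftrightarrow>
     prob_space N \<and> Z \<in> borel_measurable N \<and> (AE \<omega> in N. 0 \<le> Z \<omega>) \<and>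
     integrable N Z \<and> (\<integral>\<omega>. Z \<omega> \<partial>N) = 1 \<and>
     (\<forall>\<mu>\<in>\<D>. ssd \<mu> (\<lambda>x. x / (\<integral>y. y \<partial>\<mu>)) N Z)"

definition gfun :: "'b measure \<Rightarrow> ('b \<Rightarrow> real) \<Rightarrow> real \<Rightarrow> real" where
  "gfun N Z x = (\<integral>\<omega>. max (x * Z \<omega>) 1 \<partial>N)"

text \<open>Jobs are \<open>{..<n}\<close>, machines are \<open>{..<m}\<close>.\<close>

definition sebp_instance ::
    "'a measure \<Rightarrow> nat \<Rightarrow> nat \<Rightarrow> (nat \<Rightarrow> 'a \<Rightarrow> real) \<Rightarrow> bool" where
  "sebp_instance M m n P \<longleftrightarrow>
     prob_space M \<and> 0 < m \<and> m < n \<and>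
     prob_space.indep_vars M (\<lambda>_. borel) P {..<n} \<and>
     (\<forall>j<n. integrable M (P j) \<and> (\<forall>\<omega>\<in>space M. 0 \<le> P j \<omega>))"

text \<open>The underlying set is \<open>{..<n} \<rightarrow>\<^sub>E {0..}\<close>.\<close>

definition realizations :: "nat \<Rightarrow> (nat \<Rightarrow> real) measure" where
  "realizations n = (\<Pi>\<^sub>M j\<in>{..<n}. restrict_space borel {0..})"

text \<open>A schedule consists of the start times and the machine assignment.\<close>

type_synonym schedule = "(nat \<Rightarrow> real) \<times> (nat \<Rightarrow> nat)"
type_synonym policy = "(nat \<Rightarrow> real) \<Rightarrow> schedule"

definition feasible_schedule :: "nat \<Rightarrow> nat \<Rightarrow> (nat \<Rightarrow> real) \<Rightarrow> schedule \<Rightarrow> bool" where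
  "feasible_schedule m n p S \<longleftrightarrow>
     (\<forall>j<n. 0 \<le> fst S j \<and> snd S j < m) \<and>
     (\<forall>j<n. \<forall>k<n. j \<noteq> k \<longrightarrow> snd S j = snd S k \<longrightarrow>
        {fst S j..<fst S j + p j} \<inter> {fst S k..<fst S k + p k} = {})"

text \<open>
  What is known, when the jobs of the list \<open>js\<close> have been started and the time
  is \<open>t\<close>: these jobs, their start times and machines, and the processing times of those
  that are completed; of the others it is known only that they are still running.
\<close>

definition history ::
    "(nat \<Rightarrow> real) \<Rightarrow> schedule \<Rightarrow> nat list \<Rightarrow> real \<Rightarrow> (nat \<times> real \<times> nat \<times> real option) list" where
  "history p S js t =
     map (\<lambda>j. (j, fst S j, snd S j, if fst S j + p j \<le> t then Some (p j) else None)) js"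

text \<open>
  The jobs are started one after the other, in an order \<open>\<sigma> p\<close> with nondecreasing start
  times, and each start decision (job, time and machine) is a function of the history at the
  moment it is taken. The order serialises decisions taken at the same instant. This matters
  because processing times may be zero: a job may start at the very instant at
  which a job of length zero is started and found completed.
\<close>

definition nonanticipative :: "nat \<Rightarrow> policy \<Rightarrow> bool" where
  "nonanticipative n \<pi> \<longleftrightarrow>
     (\<exists>\<sigma> :: (nat \<Rightarrow> real) \<Rightarrow> nat list.
        (\<forall>p\<in>space (realizations n).
           distinct (\<sigma> p) \<and> set (\<sigma> p) = {..<n} \<and> sorted (map (fst (\<pi> p)) (\<sigma> p))) \<and>
        (\<forall>p\<in>space (realizations n). \<forall>p'\<in>space (realizations n). \<forall>k<n.
           let j = \<sigma> p ! k; t = fst (\<pi> p) j in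
             history p (\<pi> p) (take k (\<sigma> p)) t = history p' (\<pi> p') (take k (\<sigma> p')) t \<longrightarrow>
             \<sigma> p' ! k = j \<and> fst (\<pi> p') j = t \<and> snd (\<pi> p') j = snd (\<pi> p) j))"

definition scheduling_policy :: "nat \<Rightarrow> nat \<Rightarrow> policy \<Rightarrow> bool" where
  "scheduling_policy m n \<pi> \<longleftrightarrow>
     (\<forall>j<n. (\<lambda>p. fst (\<pi> p) j) \<in> borel_measurable (realizations n) \<and>
            (\<lambda>p. snd (\<pi> p) j) \<in> measurable (realizations n) (count_space UNIV)) \<and>
     (\<forall>p\<in>space (realizations n). feasible_schedule m n p (\<pi> p)) \<and>
     nonanticipative n \<pi>"

text \<open>A machine without jobs has completion time \<open>0\<close>.\<close>

definition machine_completion ::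
    "nat \<Rightarrow> (nat \<Rightarrow> real) \<Rightarrow> schedule \<Rightarrow> nat \<Rightarrow> real" where
  "machine_completion n p S i = Max (insert 0 {fst S j + p j | j. j < n \<and> snd S j = i})"

text \<open>
  The cost is a nonnegative extended real, as the expectation may be infinite for a policy
  that idles.
\<close>

definition policy_cost ::
    "'a measure \<Rightarrow> nat \<Rightarrow> nat \<Rightarrow> (nat \<Rightarrow> 'a \<Rightarrow> real) \<Rightarrow> policy \<Rightarrow> ennreal" where
  "policy_cost M m n P \<pi> =
     (\<integral>\<^sup>+\<omega>. (let p = (\<lambda>j\<in>{..<n}. P j \<omega>) in
        ennreal (\<Sum>i<m. max (machine_completion n p (\<pi> p) i) 1)) \<partial>M)"

definition opt_cost ::
    "'a measure \<Rightarrow> nat \<Rightarrow> nat \<Rightarrow> (nat \<Rightarrow> 'a \<Rightarrow> real) \<Rightarrow> ennreal" where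
  "opt_cost M m n P = (INF \<pi>\<in>{\<pi>. scheduling_policy m n \<pi>}. policy_cost M m n P \<pi>)"

text \<open>
  \<open>\<sigma>\<close> is the order in which the jobs are considered and \<open>a\<close> the resulting assignment; ties,
  both in the order and in the choice of the machine, are broken arbitrarily.
\<close>

definition lept_assignment ::
    "'a measure \<Rightarrow> nat \<Rightarrow> nat \<Rightarrow> (nat \<Rightarrow> 'a \<Rightarrow> real) \<Rightarrow> nat list \<Rightarrow> (nat \<Rightarrow> nat) \<Rightarrow> bool" where
  "lept_assignment M m n P \<sigma> a \<longleftrightarrow>
     distinct \<sigma> \<and> set \<sigma> = {..<n} \<and>
     sorted_wrt (\<lambda>j k. (\<integral>\<omega>. P j \<omega> \<partial>M) \<ge> (\<integral>\<omega>. P k \<omega> \<partial>M)) \<sigma> \<and>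
     (\<forall>k<n. is_arg_min
        (\<lambda>i. \<Sum>j\<leftarrow>filter (\<lambda>j. a j = i) (take k \<sigma>). \<integral>\<omega>. P j \<omega> \<partial>M)
        (\<lambda>i. i < m) (a (\<sigma> ! k)))"

definition fixed_assignment_policy :: "nat list \<Rightarrow> (nat \<Rightarrow> nat) \<Rightarrow> policy" where
  "fixed_assignment_policy \<sigma> a p =
     (\<lambda>j. \<Sum>l\<leftarrow>filter (\<lambda>l. a l = a j) (takeWhile (\<lambda>l. l \<noteq> j) \<sigma>). p l, a)"

end

theory Submission
  imports Defs
begin

text \<open>
  Let \<open>e\<^sub>j\<close> be the expected processing times and \<open>x\<^sub>i\<close> the expected machine loads under LEPT.
  Writing the load of a machine as a convex combination of the rescaled variables
  \<open>x\<^sub>i P\<^sub>j / e\<^sub>j\<close>, convexity and second-order dominance bound the cost of machine \<open>i\<close>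
  by \<open>g(x\<^sub>i)\<close>. On the other side, realization by realization every feasible schedule costs at
  least \<open>\<Sum>\<^sub>j P\<^sub>j\<close> and at least \<open>m + \<Sum>\<^sub>j (P\<^sub>j - 1)\<^sup>+\<close>, so the optimum is at least the maximum of
  \<open>\<Sum>\<^sub>j e\<^sub>j\<close> and \<open>m + \<Sum>\<^sub>j (e\<^sub>j - 1)\<^sup>+\<close>.

  Let \<open>t\<close> be the smallest load. A machine with at least two jobs has load at most \<open>2t\<close>. The
  single-job machines of load greater than \<open>1\<close> are paid for by \<open>g(x) \<le> x g(1)\<close>. If \<open>1/2 \<le> t < 1\<close>,
  the other loads lie in \<open>[t, 2t]\<close>, where \<open>g\<close> is below its chord; the chord has nonnegative
  slope and nonnegative intercept \<open>2g(t) - g(2t)\<close>, and its value at \<open>1\<close> is the bracket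
  in the supremum. If \<open>t < 1/2\<close> those loads are at most \<open>1\<close>, and if \<open>t \<ge> 1\<close> all loads are at
  least \<open>1\<close>; in both cases \<open>g(1)\<close>, the bracket at \<open>1\<close>, suffices.
\<close>

lemma integrable_max_one:
  fixes f :: "'a \<Rightarrow> real"
  assumes "prob_space M" "integrable M f"
  shows "integrable M (\<lambda>\<omega>. max (f \<omega>) 1)"
proof -
  interpret prob_space M by fact
  show ?thesis using assms(2) by simp
qed

lemma gfun_eq_expectation_min:
  assumes "prob_space N" "integrable N Z"
  shows "gfun N Z x = x * (\<integral>\<omega>. Z \<omega> \<partial>N) + 1 - (\<integral>\<omega>. min (x * Z \<omega>) 1 \<partial>N)"
proof -
  interpret prob_space N by fact
  have i: "integrable N (\<lambda>\<omega>. x * Z \<omega>)" using assms(2) by simp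
  have "gfun N Z x = (\<integral>\<omega>. x * Z \<omega> + 1 - min (x * Z \<omega>) 1 \<partial>N)"
    unfolding gfun_def by (rule Bochner_Integration.integral_cong) auto
  also have "\<dots> = x * (\<integral>\<omega>. Z \<omega> \<partial>N) + 1 - (\<integral>\<omega>. min (x * Z \<omega>) 1 \<partial>N)"
    using i by (simp add: prob_space)
  finally show ?thesis .
qed

lemma concave_on_min_linear: "concave_on UNIV (\<lambda>y::real. min (x * y) 1)"
proof -
  have "convex_on UNIV (\<lambda>y::real. max (- x * y) (- 1))"
  proof (rule convex_onI)
    fix s y z :: real assume s: "0 < s" "s < 1"
    have "- x * ((1 - s) * y + s * z) \<le> (1 - s) * max (- x * y) (- 1) + s * max (- x * z) (- 1)"
    proof -
      have "(1 - s) * (- x * y) \<le> (1 - s) * max (- x * y) (- 1)"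
        "s * (- x * z) \<le> s * max (- x * z) (- 1)"
        using s by (intro mult_left_mono; simp)+
      then show ?thesis by (simp add: algebra_simps)
    qed
    moreover have "- 1 \<le> (1 - s) * max (- x * y) (- 1) + s * max (- x * z) (- 1)"
    proof -
      have "(1 - s) * (- 1) \<le> (1 - s) * max (- x * y) (- 1)"
        "s * (- 1) \<le> s * max (- x * z) (- 1)"
        using s by (intro mult_left_mono; simp)+
      then show ?thesis by (simp add: algebra_simps)
    qed
    ultimately show "max (- x * ((1 - s) *\<^sub>R y + s *\<^sub>R z)) (- 1)
        \<le> (1 - s) * max (- x * y) (- 1) + s * max (- x * z) (- 1)" by simp
  qed simp
  moreover have "(\<lambda>y. - min (x * y) 1) = (\<lambda>y::real. max (- x * y) (- 1))"
    by (auto simp: fun_eq_iff min_def max_def)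
  ultimately show ?thesis by (simp add: concave_on_def)
qed

lemma dominated_element_gfun_bound:
  fixes Q :: "'a \<Rightarrow> real"
  assumes D: "rv_family \<D>" "dominated_element \<D> N Z"
    and M: "prob_space M" "integrable M Q" "distr M borel Q \<in> \<D>" and x: "0 \<le> x"
  shows "(\<integral>\<omega>. max (x * (Q \<omega> / (\<integral>\<omega>. Q \<omega> \<partial>M))) 1 \<partial>M) \<le> gfun N Z x"
proof -
  interpret M: prob_space M by fact
  interpret N: prob_space N using D(2) by (simp add: dominated_element_def)
  define e where "e = (\<integral>\<omega>. Q \<omega> \<partial>M)"
  let ?\<mu> = "distr M borel Q" and ?u = "\<lambda>y::real. min (x * y) 1"
  have Qm [measurable]: "Q \<in> borel_measurable M" using M(2) by simp
  have mean: "(\<integral>y. y \<partial>?\<mu>) = e" by (simp add: integral_distr e_def)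
  have e: "e > 0" using D(1) M(3) mean by (auto simp: rv_family_def)
  have Z: "integrable N Z" "(\<integral>\<omega>. Z \<omega> \<partial>N) = 1" using D(2) by (auto simp: dominated_element_def)
  have "ssd ?\<mu> (\<lambda>y. y / e) N Z" using D(2) M(3) mean by (auto simp: dominated_element_def)
  moreover have "mono ?u" using x by (auto intro!: monoI mult_left_mono min.mono)
  moreover have "integrable M (\<lambda>\<omega>. ?u (Q \<omega> / e))" using M(2) by simp
  then have "integrable ?\<mu> (\<lambda>y. ?u (y / e))" by (simp add: integrable_distr_eq)
  moreover have "integrable N (\<lambda>\<omega>. ?u (Z \<omega>))" using Z by simp
  ultimately have "(\<integral>\<omega>. ?u (Z \<omega>) \<partial>N) \<le> (\<integral>y. ?u (y / e) \<partial>?\<mu>)"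
    using concave_on_min_linear[of x] unfolding ssd_def by blast
  also have "\<dots> = (\<integral>\<omega>. ?u (Q \<omega> / e) \<partial>M)" by (simp add: integral_distr)
  finally have "(\<integral>\<omega>. ?u (Z \<omega>) \<partial>N) \<le> (\<integral>\<omega>. ?u (Q \<omega> / e) \<partial>M)" .
  moreover have "(\<integral>\<omega>. Q \<omega> / e \<partial>M) = 1" using e by (simp add: e_def)
  ultimately have "gfun M (\<lambda>\<omega>. Q \<omega> / e) x \<le> gfun N Z x"
    using M Z by (simp add: gfun_eq_expectation_min M.prob_space_axioms N.prob_space_axioms)
  then show ?thesis by (simp add: gfun_def e_def)
qed

lemma expected_max_load_le_gfun:
  fixes P :: "'c \<Rightarrow> 'a \<Rightarrow> real"
  assumes D: "rv_family \<D>" "dominated_element \<D> N Z" and M: "prob_space M"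
    and J: "finite J" "\<And>j. j \<in> J \<Longrightarrow> integrable M (P j)"
      "\<And>j. j \<in> J \<Longrightarrow> distr M borel (P j) \<in> \<D>"
  shows "(\<integral>\<omega>. max (\<Sum>j\<in>J. P j \<omega>) 1 \<partial>M) \<le> gfun N Z (\<Sum>j\<in>J. \<integral>\<omega>. P j \<omega> \<partial>M)"
proof (cases "J = {}")
  case True
  interpret M: prob_space M by fact
  interpret N: prob_space N using D(2) by (simp add: dominated_element_def)
  show ?thesis using True by (simp add: gfun_def M.prob_space N.prob_space)
next
  case False
  interpret M: prob_space M by fact
  define e where "e j = (\<integral>\<omega>. P j \<omega> \<partial>M)" for j
  define x where "x = (\<Sum>j\<in>J. e j)"
  have e: "e j > 0" if "j \<in> J" for j
  proof -
    have "(\<integral>y. y \<partial>distr M borel (P j)) = e j"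
      using J(2)[OF that] by (simp add: integral_distr e_def)
    then show ?thesis using D(1) J(3)[OF that] by (auto simp: rv_family_def)
  qed
  have x: "x > 0" unfolding x_def using J(1) False e by (intro sum_pos) auto
  have w: "(\<Sum>j\<in>J. e j / x) = 1" using x by (simp add: x_def flip: sum_divide_distrib)
  let ?R = "\<lambda>j \<omega>. max (x * (P j \<omega> / e j)) 1"
  have int: "integrable M (?R j)" if "j \<in> J" for j
    using J(2)[OF that] by (intro integrable_max_one) (auto simp: M.prob_space_axioms)
  have "max (\<Sum>j\<in>J. P j \<omega>) 1 \<le> (\<Sum>j\<in>J. e j / x * ?R j \<omega>)" for \<omega>
  proof (rule max.boundedI)
    have "(\<Sum>j\<in>J. P j \<omega>) = (\<Sum>j\<in>J. e j / x * (x * (P j \<omega> / e j)))"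
      using e x by (intro sum.cong) (auto simp: less_imp_neq[symmetric])
    also have "\<dots> \<le> (\<Sum>j\<in>J. e j / x * ?R j \<omega>)"
      using e x by (intro sum_mono mult_left_mono) (auto simp: less_imp_le)
    finally show "(\<Sum>j\<in>J. P j \<omega>) \<le> (\<Sum>j\<in>J. e j / x * ?R j \<omega>)" .
    have "1 = (\<Sum>j\<in>J. e j / x * 1)" using w by simp
    also have "\<dots> \<le> (\<Sum>j\<in>J. e j / x * ?R j \<omega>)"
      using e x by (intro sum_mono mult_left_mono) (auto simp: less_imp_le)
    finally show "1 \<le> (\<Sum>j\<in>J. e j / x * ?R j \<omega>)" .
  qed
  then have "(\<integral>\<omega>. max (\<Sum>j\<in>J. P j \<omega>) 1 \<partial>M) \<le> (\<integral>\<omega>. (\<Sum>j\<in>J. e j / x * ?R j \<omega>) \<partial>M)"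
    using J(2) int by (intro integral_mono integrable_max_one) (auto simp: M.prob_space_axioms)
  also have "\<dots> = (\<Sum>j\<in>J. e j / x * (\<integral>\<omega>. ?R j \<omega> \<partial>M))"
    using int by (subst Bochner_Integration.integral_sum) auto
  also have "\<dots> \<le> (\<Sum>j\<in>J. e j / x * gfun N Z x)"
    using dominated_element_gfun_bound[OF D M J(2,3), of _ x] e x
    by (intro sum_mono mult_left_mono) (auto simp: less_imp_le e_def)
  also have "\<dots> = gfun N Z x" using w by (simp only: mult_1 flip: sum_distrib_right)
  finally show ?thesis by (simp add: x_def e_def)
qed

lemma gfun_mono_pointwise:
  assumes N: "prob_space N" "integrable N Z" "AE \<omega> in N. 0 \<le> Z \<omega>"
    and le: "\<And>z. 0 \<le> z \<Longrightarrow> max (x * z) 1 \<le> c * max (y * z) 1 + d * max (w * z) 1"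
  shows "gfun N Z x \<le> c * gfun N Z y + d * gfun N Z w"
proof -
  have i: "integrable N (\<lambda>\<omega>. max (v * Z \<omega>) 1)" for v
    using N by (intro integrable_max_one) auto
  have "gfun N Z x \<le> (\<integral>\<omega>. c * max (y * Z \<omega>) 1 + d * max (w * Z \<omega>) 1 \<partial>N)"
    unfolding gfun_def using i N(3) le
    by (intro integral_mono_AE) auto
  also have "\<dots> = c * gfun N Z y + d * gfun N Z w"
    unfolding gfun_def using i by simp
  finally show ?thesis .
qed

locale dominated_rv =
  fixes N :: "'b measure" and Z :: "'b \<Rightarrow> real"
  assumes N: "prob_space N" "integrable N Z" "AE \<omega> in N. 0 \<le> Z \<omega>"
begin

lemma gfun_mono: "x \<le> y \<Longrightarrow> gfun N Z x \<le> gfun N Z y"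
proof -
  assume xy: "x \<le> y"
  have "max (x * z) 1 \<le> 1 * max (y * z) 1 + 0 * max (0 * z) 1" if "0 \<le> z" for z
    using mult_right_mono[OF xy that] by auto
  from gfun_mono_pointwise[OF N this] show ?thesis by simp
qed

lemma one_le_gfun: "1 \<le> gfun N Z x"
proof -
  interpret prob_space N by (rule N)
  have "(\<integral>\<omega>. 1 \<partial>N) \<le> gfun N Z x"
    unfolding gfun_def using N by (intro integral_mono integrable_max_one) auto
  then show ?thesis by (simp add: prob_space)
qed

lemma gfun_le_scale: "1 \<le> x \<Longrightarrow> gfun N Z x \<le> x * gfun N Z 1"
proof -
  assume x: "1 \<le> x"
  have "max (x * z) 1 \<le> x * max z 1" if "0 \<le> z" for z
  proof (rule max.boundedI)
    show "x * z \<le> x * max z 1" using x by (intro mult_left_mono) auto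
    show "1 \<le> x * max z 1" using x mult_mono[of 1 x 1 "max z 1"] by simp
  qed
  then show ?thesis using gfun_mono_pointwise[OF N, of x x 1 0 0] by simp
qed

lemma gfun_double: "gfun N Z (2 * t) \<le> 2 * gfun N Z t"
proof -
  have "max (2 * t * z) 1 \<le> 2 * max (t * z) 1" for z
    by (auto simp: max_def)
  then show ?thesis using gfun_mono_pointwise[OF N, of "2 * t" 2 t 0 0] by simp
qed

lemma gfun_chord:
  assumes "0 < t" "t \<le> x" "x \<le> 2 * t"
  shows "gfun N Z x
    \<le> (2 * gfun N Z t - gfun N Z (2 * t)) + (gfun N Z (2 * t) - gfun N Z t) / t * x"
proof -
  define c where "c = x / t"
  have c: "1 \<le> c" "c \<le> 2" and x: "x = c * t" using assms by (auto simp: c_def field_simps)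
  have "max (x * z) 1 \<le> (2 - c) * max (t * z) 1 + (c - 1) * max (2 * t * z) 1" for z
  proof (rule max.boundedI)
    have "(2 - c) * (t * z) \<le> (2 - c) * max (t * z) 1"
      "(c - 1) * (2 * t * z) \<le> (c - 1) * max (2 * t * z) 1"
      using c by (auto intro!: mult_left_mono)
    then show "x * z \<le> (2 - c) * max (t * z) 1 + (c - 1) * max (2 * t * z) 1"
      by (simp add: x algebra_simps)
    have "(2 - c) * 1 \<le> (2 - c) * max (t * z) 1"
      "(c - 1) * 1 \<le> (c - 1) * max (2 * t * z) 1"
      using c by (intro mult_left_mono; simp)+
    then show "1 \<le> (2 - c) * max (t * z) 1 + (c - 1) * max (2 * t * z) 1" by simp
  qed
  from gfun_mono_pointwise[OF N this]
  have "gfun N Z x \<le> (2 - c) * gfun N Z t + (c - 1) * gfun N Z (2 * t)" .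
  also have "\<dots> = (2 * gfun N Z t - gfun N Z (2 * t)) + (gfun N Z (2 * t) - gfun N Z t) / t * x"
    using assms by (simp add: c_def field_simps)
  finally show ?thesis .
qed

lemma sum_gfun_le:
  fixes x :: "nat \<Rightarrow> real"
  assumes B: "B \<subseteq> {..<m}" "\<And>i. i \<in> B \<Longrightarrow> 1 < x i"
    and t: "\<And>i. i < m \<Longrightarrow> t \<le> x i" and t2: "\<And>i. i < m \<Longrightarrow> i \<notin> B \<Longrightarrow> x i \<le> max 1 (2 * t)"
    and L: "(\<Sum>i<m. x i) \<le> C" "m + (\<Sum>i\<in>B. x i - 1) \<le> C"
  shows "\<exists>s\<in>{0<..1}. (\<Sum>i<m. gfun N Z (x i))
    \<le> max (gfun N Z 1) ((2 - 1 / s) * gfun N Z s + (1 / s - 1) * gfun N Z (2 * s)) * C"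
proof -
  let ?g = "gfun N Z"
  let ?h = "\<lambda>s. (2 - 1 / s) * ?g s + (1 / s - 1) * ?g (2 * s)"
  let ?R = "{..<m} - B"
  have finB: "finite B" using B(1) finite_subset by blast
  have split: "(\<Sum>i<m. f i) = (\<Sum>i\<in>B. f i) + (\<Sum>i\<in>?R. f i)" for f :: "nat \<Rightarrow> real"
    using B(1) by (simp add: sum.subset_diff add.commute)
  have cR: "real (card ?R) = real m - real (card B)"
    using B(1) card_mono[OF _ B(1)] by (simp add: card_Diff_subset finB of_nat_diff)
  have LB: "(\<Sum>i\<in>B. x i) + max (card ?R) (\<Sum>i\<in>?R. x i) \<le> C"
    using L split[of x] by (auto simp: cR sum_subtractf max_def)
  have main: "(\<Sum>i<m. ?g (x i)) \<le> K * C"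
    if K: "?g 1 \<le> K" and pq: "0 \<le> p" "0 \<le> q" "p + q \<le> K"
      and R: "\<And>i. i \<in> ?R \<Longrightarrow> ?g (x i) \<le> p + q * x i" for K p q
  proof -
    let ?T = "max (real (card ?R)) (\<Sum>i\<in>?R. x i)"
    have "(\<Sum>i\<in>B. ?g (x i)) \<le> (\<Sum>i\<in>B. K * x i)"
    proof (rule sum_mono)
      fix i assume "i \<in> B"
      then have x: "1 < x i" by (rule B(2))
      then have "?g (x i) \<le> x i * ?g 1" by (intro gfun_le_scale) simp
      also have "\<dots> \<le> x i * K" using K x by (intro mult_left_mono) auto
      finally show "?g (x i) \<le> K * x i" by (simp add: mult.commute)
    qed
    moreover have "(\<Sum>i\<in>?R. ?g (x i)) \<le> K * ?T"
    proof -
      have "(\<Sum>i\<in>?R. ?g (x i)) \<le> (\<Sum>i\<in>?R. p + q * x i)" using R by (rule sum_mono)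
      also have "\<dots> = p * card ?R + q * (\<Sum>i\<in>?R. x i)"
        by (simp add: sum.distrib sum_distrib_left)
      also have "\<dots> \<le> p * ?T + q * ?T" using pq by (intro add_mono mult_left_mono) auto
      also have "\<dots> = (p + q) * ?T" by (simp add: algebra_simps)
      also have "\<dots> \<le> K * ?T" using pq by (intro mult_right_mono) auto
      finally show ?thesis .
    qed
    ultimately have "(\<Sum>i<m. ?g (x i)) \<le> K * ((\<Sum>i\<in>B. x i) + ?T)"
      by (simp add: split algebra_simps sum_distrib_left)
    also have "\<dots> \<le> K * C" using LB K one_le_gfun[of 1] by (intro mult_left_mono) auto
    finally show ?thesis .
  qed
  have g1: "0 \<le> ?g 1" using one_le_gfun[of 1] by linarith
  consider "t \<ge> 1" | "t < 1 / 2" | "1 / 2 \<le> t" "t < 1" by linarith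
  then show ?thesis
  proof cases
    case 1
    have "(\<Sum>i<m. ?g (x i)) \<le> max (?g 1) (?h 1) * C"
    proof (rule main[of _ 0 "?g 1"])
      fix i assume "i \<in> ?R"
      then have "1 \<le> x i" using t[of i] 1 by auto
      then show "?g (x i) \<le> 0 + ?g 1 * x i" using gfun_le_scale[of "x i"] by (simp add: mult.commute)
    qed (use g1 in auto)
    then show ?thesis by (intro bexI[of _ 1]) auto
  next
    case 2
    have "(\<Sum>i<m. ?g (x i)) \<le> max (?g 1) (?h 1) * C"
    proof (rule main[of _ "?g 1" 0])
      fix i assume "i \<in> ?R"
      then have "x i \<le> 1" using t2[of i] 2 by auto
      then show "?g (x i) \<le> ?g 1 + 0 * x i" using gfun_mono by simp
    qed (use g1 in auto)
    then show ?thesis by (intro bexI[of _ 1]) auto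
  next
    case 3
    have "(\<Sum>i<m. ?g (x i)) \<le> max (?g 1) (?h t) * C"
    proof (rule main[of _ "2 * ?g t - ?g (2 * t)" "(?g (2 * t) - ?g t) / t"])
      fix i assume "i \<in> ?R"
      then have "t \<le> x i" "x i \<le> 2 * t" using t[of i] t2[of i] 3 by auto
      then show "?g (x i) \<le> 2 * ?g t - ?g (2 * t) + (?g (2 * t) - ?g t) / t * x i"
        using 3 by (intro gfun_chord) auto
    next
      have "2 * ?g t - ?g (2 * t) + (?g (2 * t) - ?g t) / t = ?h t"
        using 3 by (simp add: field_simps)
      then show "2 * ?g t - ?g (2 * t) + (?g (2 * t) - ?g t) / t \<le> max (?g 1) (?h t)" by simp
    qed (use 3 gfun_double[of t] gfun_mono[of t "2 * t"] in auto)
    then show ?thesis using 3 by (intro bexI[of _ t]) auto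
  qed
qed

end

lemma lept_load_le_twice:
  fixes M :: "'a measure" and P :: "nat \<Rightarrow> 'a \<Rightarrow> real"
  defines "e \<equiv> \<lambda>j. \<integral>\<omega>. P j \<omega> \<partial>M"
  assumes lept: "lept_assignment M m n P \<sigma> a" and e: "\<And>j. j < n \<Longrightarrow> 0 \<le> e j"
    and k: "k < m" and i: "1 < card {j\<in>{..<n}. a j = i}"
  shows "(\<Sum>j | j \<in> {..<n} \<and> a j = i. e j) \<le> 2 * (\<Sum>j | j \<in> {..<n} \<and> a j = k. e j)"
proof -
  have \<sigma>: "distinct \<sigma>" "set \<sigma> = {..<n}" "sorted_wrt (\<lambda>j k. e j \<ge> e k) \<sigma>"
    and amin: "\<And>q. q < n \<Longrightarrow> is_arg_min
        (\<lambda>i. \<Sum>j\<leftarrow>filter (\<lambda>j. a j = i) (take q \<sigma>). e j) (\<lambda>i. i < m) (a (\<sigma> ! q))"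
    using lept by (auto simp: lept_assignment_def e_def)
  have len: "length \<sigma> = n" using distinct_card[OF \<sigma>(1)] \<sigma>(2) by simp
  define F where "F q i = {j \<in> set (take q \<sigma>). a j = i}" for q i
  have load: "(\<Sum>j\<leftarrow>filter (\<lambda>j. a j = i) (take q \<sigma>). e j) = sum e (F q i)" for q i
    using \<sigma>(1) by (subst sum_list_distinct_conv_sum_set) (auto simp: F_def)
  define Q where "Q = {q. q < n \<and> a (\<sigma> ! q) = i}"
  have J: "{j\<in>{..<n}. a j = i} = (!) \<sigma> ` Q"
    unfolding \<sigma>(2)[symmetric] by (auto simp: Q_def set_conv_nth len)
  have cQ: "1 < card Q" using i[unfolded J] card_image_le[of Q "(!) \<sigma>"] by (simp add: Q_def)
  define q where "q = Max Q"
  have finQ: "finite Q" by (simp add: Q_def)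
  have qQ: "q \<in> Q" unfolding q_def using cQ finQ by (intro Max_in) auto
  have q: "q < n" "a (\<sigma> ! q) = i" using qQ by (auto simp: Q_def)
  obtain r where r: "r \<in> Q" "r \<noteq> q"
    using cQ qQ by (metis card_le_Suc0_iff_eq finQ One_nat_def not_le)
  have "r < q" using r finQ by (simp add: q_def order.not_eq_order_implies_strict)
  then have rF: "\<sigma> ! r \<in> F q i"
    using r q len by (auto simp: F_def Q_def in_set_conv_nth intro!: exI[of _ r])
  have "e (\<sigma> ! q) \<le> e (\<sigma> ! r)"
    using \<sigma>(3) \<open>r < q\<close> q len by (auto simp: sorted_wrt_iff_nth_less)
  also have "\<dots> \<le> sum e (F q i)"
    using rF e \<sigma>(2) by (intro member_le_sum) (auto simp: F_def dest!: in_set_takeD)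
  finally have last: "e (\<sigma> ! q) \<le> sum e (F q i)" .
  have "sum e (F q i) \<le> sum e (F q k)"
    using amin[OF q(1)] k q(2) by (auto simp: load is_arg_min_linorder)
  also have "\<dots> \<le> (\<Sum>j | j \<in> {..<n} \<and> a j = k. e j)"
    using e \<sigma>(2) by (intro sum_mono2) (auto simp: F_def dest!: in_set_takeD)
  finally have before: "sum e (F q i) \<le> (\<Sum>j | j \<in> {..<n} \<and> a j = k. e j)" .
  have "{j\<in>{..<n}. a j = i} \<subseteq> insert (\<sigma> ! q) (F q i)"
  proof
    fix j assume "j \<in> {j\<in>{..<n}. a j = i}"
    then obtain s where s: "s \<in> Q" "j = \<sigma> ! s" unfolding J by auto
    then have "s \<le> q" using finQ by (simp add: q_def)
    then consider "s = q" | "s < q" by linarith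
    then show "j \<in> insert (\<sigma> ! q) (F q i)"
      using s q len by cases (auto simp: F_def Q_def in_set_conv_nth intro!: exI[of _ s])
  qed
  then have "(\<Sum>j | j \<in> {..<n} \<and> a j = i. e j) \<le> sum e (insert (\<sigma> ! q) (F q i))"
    using e \<sigma>(2) q len by (intro sum_mono2) (auto simp: F_def dest!: in_set_takeD nth_mem)
  also have "\<dots> \<le> e (\<sigma> ! q) + sum e (F q i)"
    using e q \<sigma>(2) len nth_mem[of q \<sigma>] by (subst sum.insert_if) (auto simp: F_def)
  finally show ?thesis using last before by linarith
qed

lemma machine_completion_ge:
  assumes S: "feasible_schedule m n p S" and p: "\<And>j. j < n \<Longrightarrow> 0 \<le> p j"
  shows "(\<Sum>j | j \<in> {..<n} \<and> snd S j = i. p j) \<le> machine_completion n p S i"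
proof -
  let ?J = "{j\<in>{..<n}. snd S j = i}" and ?X = "machine_completion n p S i"
  let ?I = "\<lambda>j. {fst S j..<fst S j + p j}"
  have fin: "finite (insert 0 {fst S j + p j | j. j < n \<and> snd S j = i})" by simp
  have X: "fst S j + p j \<le> ?X" if "j \<in> ?J" for j
    unfolding machine_completion_def using that by (intro Max_ge fin) auto
  have X0: "0 \<le> ?X" unfolding machine_completion_def by (intro Max_ge fin) auto
  have disj: "disjoint_family_on ?I ?J"
    unfolding disjoint_family_on_def
  proof (intro ballI impI)
    fix j k assume "j \<in> ?J" "k \<in> ?J" "j \<noteq> k"
    then show "?I j \<inter> ?I k = {}"
      using S unfolding feasible_schedule_def mem_Collect_eq lessThan_iff by blast
  qed
  have "(\<Sum>j\<in>?J. p j) = (\<Sum>j\<in>?J. measure lborel (?I j))"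
    using p by (intro sum.cong) auto
  also have "\<dots> = measure lborel (\<Union>j\<in>?J. ?I j)"
    using disj p by (intro measure_finite_Union[symmetric]) auto
  also have "\<dots> \<le> measure lborel {0..?X}"
  proof (rule measure_mono_fmeasurable)
    show "(\<Union>j\<in>?J. ?I j) \<subseteq> {0..?X}"
    proof
      fix y assume "y \<in> (\<Union>j\<in>?J. ?I j)"
      then obtain j where j: "j \<in> ?J" "y \<in> ?I j" by blast
      have "0 \<le> fst S j" using S j(1) by (simp add: feasible_schedule_def)
      then show "y \<in> {0..?X}" using X[OF j(1)] j(2) by auto
    qed
  qed (auto intro!: fmeasurable_compact)
  also have "\<dots> = ?X" using X0 by simp
  finally show ?thesis .
qed

lemma feasible_schedule_cost_ge:
  assumes S: "feasible_schedule m n p S" and p: "\<And>j. j < n \<Longrightarrow> 0 \<le> p j"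
  shows "(\<Sum>j<n. p j) \<le> (\<Sum>i<m. max (machine_completion n p S i) 1)"
    and "m + (\<Sum>j<n. max (p j - 1) 0) \<le> (\<Sum>i<m. max (machine_completion n p S i) 1)"
proof -
  let ?J = "\<lambda>i. {j\<in>{..<n}. snd S j = i}"
  have group: "(\<Sum>j<n. f j) = (\<Sum>i<m. \<Sum>j\<in>?J i. f j)" for f :: "nat \<Rightarrow> real"
    using S by (intro sum.group[symmetric]) (auto simp: feasible_schedule_def)
  have load: "(\<Sum>j\<in>?J i. p j) \<le> machine_completion n p S i" for i
    using machine_completion_ge[OF S p] by blast
  show "(\<Sum>j<n. p j) \<le> (\<Sum>i<m. max (machine_completion n p S i) 1)"
    unfolding group using load by (intro sum_mono) (simp add: max.coboundedI1)
  have "1 + (\<Sum>j\<in>?J i. max (p j - 1) 0) \<le> max (machine_completion n p S i) 1" for i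
  proof (cases "\<exists>j\<in>?J i. 1 < p j")
    case True
    then obtain j where j: "j \<in> ?J i" "1 < p j" by blast
    have "1 + (\<Sum>j\<in>?J i. max (p j - 1) 0) = p j + (\<Sum>j\<in>?J i - {j}. max (p j - 1) 0)"
      using j by (subst sum.remove[of _ j]) auto
    also have "\<dots> \<le> p j + (\<Sum>j\<in>?J i - {j}. p j)"
      using p by (intro add_left_mono sum_mono) auto
    also have "\<dots> = (\<Sum>j\<in>?J i. p j)" using j by (subst sum.remove[of "?J i" j]) auto
    finally show ?thesis using load[of i] by simp
  next
    case False
    then have "(\<Sum>j\<in>?J i. max (p j - 1) 0) = 0" by (intro sum.neutral) (auto simp: max_def)
    then show ?thesis by simp
  qed
  then have "(\<Sum>i<m. 1 + (\<Sum>j\<in>?J i. max (p j - 1) 0)) \<le> (\<Sum>i<m. max (machine_completion n p S i) 1)"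
    by (intro sum_mono)
  then show "m + (\<Sum>j<n. max (p j - 1) 0) \<le> (\<Sum>i<m. max (machine_completion n p S i) 1)"
    by (simp add: group sum.distrib)
qed

lemma opt_cost_ge:
  fixes P :: "nat \<Rightarrow> 'a \<Rightarrow> real"
  assumes inst: "sebp_instance M m n P"
  shows "ennreal (max (\<Sum>j<n. \<integral>\<omega>. P j \<omega> \<partial>M) (m + (\<Sum>j<n. max ((\<integral>\<omega>. P j \<omega> \<partial>M) - 1) 0)))
    \<le> opt_cost M m n P"
  unfolding opt_cost_def
proof (rule INF_greatest)
  fix \<pi> assume "\<pi> \<in> {\<pi>. scheduling_policy m n \<pi>}"
  then have feas: "\<And>p. p \<in> space (realizations n) \<Longrightarrow> feasible_schedule m n p (\<pi> p)"
    by (simp add: scheduling_policy_def)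
  interpret prob_space M using inst by (simp add: sebp_instance_def)
  have P: "\<And>j. j < n \<Longrightarrow> integrable M (P j)" "\<And>j \<omega>. j < n \<Longrightarrow> \<omega> \<in> space M \<Longrightarrow> 0 \<le> P j \<omega>"
    using inst by (auto simp: sebp_instance_def)
  have ge: "ennreal (\<integral>\<omega>. f \<omega> \<partial>M) \<le> policy_cost M m n P \<pi>"
    if f: "integrable M f" "\<And>\<omega>. \<omega> \<in> space M \<Longrightarrow> 0 \<le> f \<omega>"
      and le: "\<And>\<omega> S. \<omega> \<in> space M \<Longrightarrow> feasible_schedule m n (\<lambda>j\<in>{..<n}. P j \<omega>) S \<Longrightarrow>
        f \<omega> \<le> (\<Sum>i<m. max (machine_completion n (\<lambda>j\<in>{..<n}. P j \<omega>) S i) 1)" for f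
  proof -
    have "ennreal (\<integral>\<omega>. f \<omega> \<partial>M) = (\<integral>\<^sup>+\<omega>. ennreal (f \<omega>) \<partial>M)"
      using f by (intro nn_integral_eq_integral[symmetric]) auto
    also have "\<dots> \<le> policy_cost M m n P \<pi>"
      unfolding policy_cost_def Let_def
    proof (intro nn_integral_mono ennreal_leI le feas)
      fix \<omega> assume "\<omega> \<in> space M"
      then show "(\<lambda>j\<in>{..<n}. P j \<omega>) \<in> space (realizations n)"
        using P by (auto simp: realizations_def space_PiM space_restrict_space)
    qed
    finally show ?thesis .
  qed
  have "ennreal (\<integral>\<omega>. (\<Sum>j<n. P j \<omega>) \<partial>M) \<le> policy_cost M m n P \<pi>"
  proof (rule ge)
    fix \<omega> S assume "\<omega> \<in> space M" and S: "feasible_schedule m n (\<lambda>j\<in>{..<n}. P j \<omega>) S"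
    then show "(\<Sum>j<n. P j \<omega>) \<le> (\<Sum>i<m. max (machine_completion n (\<lambda>j\<in>{..<n}. P j \<omega>) S i) 1)"
      using feasible_schedule_cost_ge(1)[OF S] P(2) by simp
  qed (use P in \<open>auto intro!: sum_nonneg\<close>)
  then have 1: "ennreal (\<Sum>j<n. \<integral>\<omega>. P j \<omega> \<partial>M) \<le> policy_cost M m n P \<pi>"
    using P by simp
  have int: "integrable M (\<lambda>\<omega>. max (P j \<omega> - 1) 0)" if "j < n" for j
    using P(1)[OF that] by simp
  have int_sum: "integrable M (\<lambda>\<omega>. m + (\<Sum>j<n. max (P j \<omega> - 1) 0))"
    using int by (intro Bochner_Integration.integrable_add Bochner_Integration.integrable_sum) auto
  have excess: "ennreal (\<integral>\<omega>. m + (\<Sum>j<n. max (P j \<omega> - 1) 0) \<partial>M) \<le> policy_cost M m n P \<pi>"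
  proof (rule ge)
    fix \<omega> S assume "\<omega> \<in> space M" and S: "feasible_schedule m n (\<lambda>j\<in>{..<n}. P j \<omega>) S"
    then show "m + (\<Sum>j<n. max (P j \<omega> - 1) 0)
        \<le> (\<Sum>i<m. max (machine_completion n (\<lambda>j\<in>{..<n}. P j \<omega>) S i) 1)"
      using feasible_schedule_cost_ge(2)[OF S] P(2) by simp
  qed (use int_sum in \<open>auto intro!: sum_nonneg add_nonneg_nonneg\<close>)
  have "max ((\<integral>\<omega>. P j \<omega> \<partial>M) - 1) 0 \<le> (\<integral>\<omega>. max (P j \<omega> - 1) 0 \<partial>M)" if "j < n" for j
  proof (rule max.boundedI)
    have "(\<integral>\<omega>. P j \<omega> \<partial>M) - 1 = (\<integral>\<omega>. P j \<omega> - 1 \<partial>M)" using P(1)[OF that] by (simp add: prob_space)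
    also have "\<dots> \<le> (\<integral>\<omega>. max (P j \<omega> - 1) 0 \<partial>M)"
      using P(1)[OF that] int[OF that] by (intro integral_mono) auto
    finally show "(\<integral>\<omega>. P j \<omega> \<partial>M) - 1 \<le> (\<integral>\<omega>. max (P j \<omega> - 1) 0 \<partial>M)" .
  qed simp
  then have "m + (\<Sum>j<n. max ((\<integral>\<omega>. P j \<omega> \<partial>M) - 1) 0)
      \<le> m + (\<Sum>j<n. \<integral>\<omega>. max (P j \<omega> - 1) 0 \<partial>M)"
    by (intro add_left_mono sum_mono) auto
  also have "\<dots> = (\<integral>\<omega>. m + (\<Sum>j<n. max (P j \<omega> - 1) 0) \<partial>M)"
    using int by (subst Bochner_Integration.integral_add)
      (auto simp: prob_space Bochner_Integration.integral_sum intro!: Bochner_Integration.integrable_sum)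
  finally have "m + (\<Sum>j<n. max ((\<integral>\<omega>. P j \<omega> \<partial>M) - 1) 0)
      \<le> (\<integral>\<omega>. m + (\<Sum>j<n. max (P j \<omega> - 1) 0) \<partial>M)" .
  then have 2: "ennreal (m + (\<Sum>j<n. max ((\<integral>\<omega>. P j \<omega> \<partial>M) - 1) 0)) \<le> policy_cost M m n P \<pi>"
    using excess ennreal_leI order_trans by blast
  show "ennreal (max (\<Sum>j<n. \<integral>\<omega>. P j \<omega> \<partial>M) (m + (\<Sum>j<n. max ((\<integral>\<omega>. P j \<omega> \<partial>M) - 1) 0)))
      \<le> policy_cost M m n P \<pi>"
    using 1 2 by (simp add: max_def)
qed

lemma fixed_assignment_completion_le:
  assumes \<sigma>: "distinct \<sigma>" "set \<sigma> = {..<n}" and p: "\<And>j. j < n \<Longrightarrow> 0 \<le> p j"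
  shows "machine_completion n p (fixed_assignment_policy \<sigma> a p) i
    \<le> (\<Sum>j | j \<in> {..<n} \<and> a j = i. p j)"
proof -
  let ?J = "{j\<in>{..<n}. a j = i}"
  let ?s = "fst (fixed_assignment_policy \<sigma> a p)"
  have "?s j + p j \<le> sum p ?J" if j: "j < n" "a j = i" for j
  proof -
    let ?F = "set (filter (\<lambda>l. a l = i) (takeWhile (\<lambda>l. l \<noteq> j) \<sigma>))"
    have "?s j = sum p ?F"
      unfolding fixed_assignment_policy_def fst_conv j(2) using \<sigma>(1)
      by (intro sum_list_distinct_conv_sum_set) (simp add: distinct_takeWhile)
    moreover have "j \<notin> ?F" by (auto dest: set_takeWhileD)
    ultimately have "?s j + p j = sum p (insert j ?F)" by simp
    also have "\<dots> \<le> sum p ?J"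
      using p j \<sigma>(2) by (intro sum_mono2) (auto dest!: set_takeWhileD)
    finally show ?thesis .
  qed
  moreover have "0 \<le> sum p ?J" using p by (intro sum_nonneg) auto
  ultimately show ?thesis
    unfolding machine_completion_def by (auto simp: fixed_assignment_policy_def)
qed

lemma fixed_assignment_cost_le:
  fixes P :: "nat \<Rightarrow> 'a \<Rightarrow> real"
  assumes D: "rv_family \<D>" "dominated_element \<D> N Z"
    and inst: "sebp_instance M m n P" "\<forall>j<n. distr M borel (P j) \<in> \<D>"
    and \<sigma>: "distinct \<sigma>" "set \<sigma> = {..<n}"
  shows "policy_cost M m n P (fixed_assignment_policy \<sigma> a)
    \<le> ennreal (\<Sum>i<m. gfun N Z (\<Sum>j | j \<in> {..<n} \<and> a j = i. \<integral>\<omega>. P j \<omega> \<partial>M))"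
proof -
  interpret prob_space M using inst by (simp add: sebp_instance_def)
  have P: "\<And>j. j < n \<Longrightarrow> integrable M (P j)" "\<And>j \<omega>. j < n \<Longrightarrow> \<omega> \<in> space M \<Longrightarrow> 0 \<le> P j \<omega>"
    using inst by (auto simp: sebp_instance_def)
  let ?J = "\<lambda>i. {j\<in>{..<n}. a j = i}"
  let ?f = "\<lambda>\<omega>. \<Sum>i<m. max (\<Sum>j\<in>?J i. P j \<omega>) 1"
  have int: "integrable M (\<lambda>\<omega>. max (\<Sum>j\<in>?J i. P j \<omega>) 1)" for i
    using P by (intro integrable_max_one) (auto simp: prob_space_axioms)
  have "policy_cost M m n P (fixed_assignment_policy \<sigma> a) \<le> (\<integral>\<^sup>+\<omega>. ennreal (?f \<omega>) \<partial>M)"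
    unfolding policy_cost_def Let_def
  proof (intro nn_integral_mono ennreal_leI sum_mono max.mono order_refl)
    fix \<omega> i assume \<omega>: "\<omega> \<in> space M"
    let ?p = "\<lambda>j\<in>{..<n}. P j \<omega>"
    have "machine_completion n ?p (fixed_assignment_policy \<sigma> a ?p) i \<le> (\<Sum>j\<in>?J i. ?p j)"
      using P \<omega> by (intro fixed_assignment_completion_le \<sigma>) auto
    also have "\<dots> = (\<Sum>j\<in>?J i. P j \<omega>)" by (intro sum.cong) auto
    finally show "machine_completion n ?p (fixed_assignment_policy \<sigma> a ?p) i \<le> (\<Sum>j\<in>?J i. P j \<omega>)" .
  qed
  also have "\<dots> = ennreal (\<integral>\<omega>. ?f \<omega> \<partial>M)"
    using int by (intro nn_integral_eq_integral) (auto intro!: sum_nonneg simp: le_max_iff_disj)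
  also have "(\<integral>\<omega>. ?f \<omega> \<partial>M) = (\<Sum>i<m. \<integral>\<omega>. max (\<Sum>j\<in>?J i. P j \<omega>) 1 \<partial>M)"
    using int by (intro Bochner_Integration.integral_sum)
  also have "\<dots> \<le> (\<Sum>i<m. gfun N Z (\<Sum>j\<in>?J i. \<integral>\<omega>. P j \<omega> \<partial>M))"
    using P inst by (intro sum_mono expected_max_load_le_gfun[OF D prob_space_axioms]) auto
  finally show ?thesis by (simp add: ennreal_leI)
qed

theorem theorem5:
  fixes \<D> :: "real measure set"
    and N :: "'b measure" and Z :: "'b \<Rightarrow> real"
    and M :: "'a measure" and P :: "nat \<Rightarrow> 'a \<Rightarrow> real" and m n :: nat
    and \<sigma> :: "nat list" and a :: "nat \<Rightarrow> nat"
  assumes "rv_family \<D>"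
    and "dominated_element \<D> N Z"
    and "sebp_instance M m n P"
    and "\<forall>j<n. distr M borel (P j) \<in> \<D>"
    and "lept_assignment M m n P \<sigma> a"
  shows "enn2ereal (policy_cost M m n P (fixed_assignment_policy \<sigma> a) / opt_cost M m n P)
    \<le> (SUP t\<in>{0<..1}. ereal ((2 - 1 / t) * gfun N Z t + (1 / t - 1) * gfun N Z (2 * t)))"
proof -
  interpret dominated_rv N Z
    using assms(2) by (intro dominated_rv.intro) (auto simp: dominated_element_def)
  let ?g = "gfun N Z" and ?OPT = "opt_cost M m n P"
  let ?LEPT = "policy_cost M m n P (fixed_assignment_policy \<sigma> a)"
  let ?h = "\<lambda>s. (2 - 1 / s) * ?g s + (1 / s - 1) * ?g (2 * s)"
  define e where "e j = (\<integral>\<omega>. P j \<omega> \<partial>M)" for j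
  define J where "J i = {j\<in>{..<n}. a j = i}" for i
  define x where "x i = (\<Sum>j\<in>J i. e j)" for i
  define t where "t = Min (x ` {..<m})"
  define B where "B = {i. i < m \<and> 1 < x i \<and> card (J i) = 1}"
  define C where "C = max (\<Sum>j<n. e j) (m + (\<Sum>j<n. max (e j - 1) 0))"
  have m: "0 < m" using assms(3) by (simp add: sebp_instance_def)
  have \<sigma>: "distinct \<sigma>" "set \<sigma> = {..<n}" using assms(5) by (auto simp: lept_assignment_def)
  have len: "length \<sigma> = n" using distinct_card[OF \<sigma>(1)] \<sigma>(2) by simp
  have e: "0 \<le> e j" if "j < n" for j
    unfolding e_def using assms(3) that
    by (intro integral_nonneg_AE) (auto simp: sebp_instance_def intro!: AE_I2)
  have am: "a j < m" if j: "j < n" for j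
  proof -
    obtain q where "q < n" "\<sigma> ! q = j" using \<sigma>(2) j len by (metis in_set_conv_nth lessThan_iff)
    then show ?thesis using assms(5) by (auto simp: lept_assignment_def is_arg_min_def)
  qed
  have group: "(\<Sum>j<n. f j) = (\<Sum>i<m. \<Sum>j\<in>J i. f j)" for f :: "nat \<Rightarrow> real"
    unfolding J_def using am by (intro sum.group[symmetric]) auto
  have finJ: "finite (J i)" for i by (simp add: J_def)
  have "\<exists>s\<in>{0<..1}. (\<Sum>i<m. ?g (x i)) \<le> max (?g 1) (?h s) * C"
  proof (rule sum_gfun_le)
    show "B \<subseteq> {..<m}" "\<And>i. i \<in> B \<Longrightarrow> 1 < x i" by (auto simp: B_def)
    show "t \<le> x i" if "i < m" for i unfolding t_def using that by (intro Min_le) auto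
    show "x i \<le> max 1 (2 * t)" if i: "i < m" "i \<notin> B" for i
    proof (cases "1 < card (J i)")
      case True
      have "t \<in> x ` {..<m}" unfolding t_def using m by (intro Min_in) auto
      then obtain k where k: "k < m" "t = x k" by auto
      have "x i \<le> 2 * x k"
        using lept_load_le_twice[OF assms(5) _ k(1), of i] True e
        by (simp add: x_def J_def e_def)
      then show ?thesis using k by simp
    next
      case False
      then consider "card (J i) = 1" | "J i = {}"
        using finJ[of i] by (metis One_nat_def card_eq_0_iff less_one nat_neq_iff)
      then show ?thesis using i by cases (auto simp: B_def x_def)
    qed
    show "(\<Sum>i<m. x i) \<le> C" by (simp add: C_def x_def group)
    have "(\<Sum>i\<in>B. x i - 1) \<le> (\<Sum>i\<in>B. \<Sum>j\<in>J i. max (e j - 1) 0)"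
    proof (rule sum_mono)
      fix i assume "i \<in> B"
      then obtain j where "J i = {j}" by (auto simp: B_def card_1_singleton_iff)
      then show "x i - 1 \<le> (\<Sum>j\<in>J i. max (e j - 1) 0)" by (simp add: x_def)
    qed
    also have "\<dots> \<le> (\<Sum>i<m. \<Sum>j\<in>J i. max (e j - 1) 0)"
      by (intro sum_mono2) (auto simp: B_def intro!: sum_nonneg)
    finally show "m + (\<Sum>i\<in>B. x i - 1) \<le> C" by (simp add: C_def group)
  qed
  then obtain s where s: "s \<in> {0<..1}" "(\<Sum>i<m. ?g (x i)) \<le> max (?g 1) (?h s) * C" by blast
  define K where "K = max (?g 1) (?h s)"
  have K: "0 \<le> K" using one_le_gfun[of 1] by (simp add: K_def le_max_iff_disj)
  have C: "0 < C" using m by (auto simp: C_def less_max_iff_disj intro!: add_pos_nonneg sum_nonneg)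
  have opt: "ennreal C \<le> ?OPT"
    using opt_cost_ge[OF assms(3)] by (simp add: C_def e_def)
  have "?LEPT \<le> ennreal (\<Sum>i<m. ?g (x i))"
    using fixed_assignment_cost_le[OF assms(1-4) \<sigma>] by (simp add: x_def J_def e_def)
  also have "\<dots> \<le> ennreal (K * C)" using s(2) by (simp add: K_def ennreal_leI)
  also have "\<dots> = ennreal K * ennreal C" using K C by (simp add: ennreal_mult)
  also have "\<dots> \<le> ennreal K * ?OPT" using opt by (rule mult_left_mono) simp
  finally have le: "?LEPT \<le> ennreal K * ?OPT" .
  have pos: "0 < ?OPT" using opt C by (metis ennreal_less_zero_iff order_less_le_trans)
  have "?LEPT / ?OPT \<le> ennreal K"
  proof (cases "?OPT = \<top>")
    case False
    then show ?thesis using le pos by (subst divide_le_posI_ennreal) (auto simp: mult.commute)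
  qed simp
  then have "enn2ereal (?LEPT / ?OPT) \<le> ereal K"
    using K by (metis enn2ereal_ennreal less_eq_ennreal.rep_eq)
  also have "ereal K \<le> (SUP t\<in>{0<..1}. ereal (?h t))"
  proof -
    have "ereal (?h 1) \<le> (SUP t\<in>{0<..1}. ereal (?h t))" "ereal (?h s) \<le> (SUP t\<in>{0<..1}. ereal (?h t))"
      using s(1) by (intro SUP_upper; simp)+
    then show ?thesis by (simp add: K_def max_def)
  qed
  finally show ?thesis .
qed

end
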